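(* Let $k\ge 3$ be an integer. There exist infinitely many (pairwise non-isomorphic) finite minimal asymmetric $k$-graphs which have maximum degree $2$ and maximum codegree $1$.
   Context: For $k\ge 2$, a $k$-graph ($k$-uniform hypergraph) is a pair $\mathcal{G}=(\mathcal{V}(\mathcal{G}),\mathcal{E}(\mathcal{G}))$ where the edge set $\mathcal{E}(\mathcal{G})$ is a set of $k$-element subsets of the finite vertex set $\mathcal{V}(\mathcal{G})$. An automorphism on a $k$-graph $\mathcal{G}=(\mathcal{V},\mathcal{E})$ is a bijection $\phi\colon\mathcal{V}\to\mathcal{V}$ such that for every $E\in\mathcal{E}$, $\{\phi(v): v\in E\}\in\mathcal{E}$. It is non-trivial if it is not the identity. $\mathcal{G}$ is symmetric if there exists a non-trivial automorphism on $\mathcal{G}$, and asymmetric otherwise. For $W\subseteq\mathcal{V}(\mathcal{G})$, the sub-hypergraph of $\mathcal{G}$ induced by $W$ has vertex set $W$ and edge set $\{E\in\mathcal{E}(\mathcal{G}): E\subseteq W\}$. $\mathcal{G}$ is minimal asymmetric if it is asymmetric and every induced sub-hypergraph $\mathcal{H}$ of $\mathcal{G}$ with $2\le|\mathcal{V}(\mathcal{H})|<|\mathcal{V}(\mathcal{G})|$ is symmetric. The degree of a vertex is the number of edges containing it; the maximum degree of $\mathcal{G}$ is the maximum over all vertices. The codegree of two distinct vertices $u,v$ is the number of edges containing both $u$ and $v$; the maximum codegree of $\mathcal{G}$ is the maximum of the codegrees over all pairs of distinct vertices. *)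

theory Defs
  imports Main
begin

type_synonym 'a hypergraph = "'a set \<times> 'a set set"

abbreviation verts :: "'a hypergraph \<Rightarrow> 'a set" where
  "verts G \<equiv> fst G"

abbreviation edges :: "'a hypergraph \<Rightarrow> 'a set set" where
  "edges G \<equiv> snd G"

definition k_graph :: "nat \<Rightarrow> 'a hypergraph \<Rightarrow> bool" where
  "k_graph k G \<longleftrightarrow>
     2 \<le> k \<and> finite (verts G) \<and> (\<forall>E\<in>edges G. E \<subseteq> verts G \<and> card E = k)"

text \<open>Automorphisms are total functions on the ambient type; only their values on the
  vertex set matter, so non-triviality is likewise tested on the vertex set only.\<close>

definition automorphism :: "'a hypergraph \<Rightarrow> ('a \<Rightarrow> 'a) \<Rightarrow> bool" where
  "automorphism G \<phi> \<longleftrightarrow>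
     bij_betw \<phi> (verts G) (verts G) \<and> (\<forall>E\<in>edges G. \<phi> ` E \<in> edges G)"

definition symmetric :: "'a hypergraph \<Rightarrow> bool" where
  "symmetric G \<longleftrightarrow> (\<exists>\<phi>. automorphism G \<phi> \<and> (\<exists>v\<in>verts G. \<phi> v \<noteq> v))"

abbreviation asymmetric :: "'a hypergraph \<Rightarrow> bool" where
  "asymmetric G \<equiv> \<not> symmetric G"

definition induced :: "'a hypergraph \<Rightarrow> 'a set \<Rightarrow> 'a hypergraph" where
  "induced G W = (W, {E \<in> edges G. E \<subseteq> W})"

definition minimal_asymmetric :: "'a hypergraph \<Rightarrow> bool" where
  "minimal_asymmetric G \<longleftrightarrow>
     asymmetric G \<and>
     (\<forall>W\<subseteq>verts G. 2 \<le> card W \<and> card W < card (verts G) \<longrightarrow> symmetric (induced G W))"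

definition isomorphic :: "'a hypergraph \<Rightarrow> 'b hypergraph \<Rightarrow> bool" where
  "isomorphic G H \<longleftrightarrow>
     (\<exists>\<phi>. bij_betw \<phi> (verts G) (verts H) \<and> (\<lambda>E. \<phi> ` E) ` edges G = edges H)"

definition degree :: "'a hypergraph \<Rightarrow> 'a \<Rightarrow> nat" where
  "degree G v = card {E \<in> edges G. v \<in> E}"

definition codegree :: "'a hypergraph \<Rightarrow> 'a \<Rightarrow> 'a \<Rightarrow> nat" where
  "codegree G u v = card {E \<in> edges G. u \<in> E \<and> v \<in> E}"

text \<open>On finite sets of naturals, \<open>Sup\<close> is the maximum, with value \<open>0\<close> on the empty set
  (where \<open>Max\<close> would be unspecified).\<close>

definition max_degree :: "'a hypergraph \<Rightarrow> nat" where
  "max_degree G = Sup {degree G v | v. v \<in> verts G}"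

definition max_codegree :: "'a hypergraph \<Rightarrow> nat" where
  "max_codegree G = Sup {codegree G u v | u v. u \<in> verts G \<and> v \<in> verts G \<and> u \<noteq> v}"

end

theory Submission imports Defs begin

text \<open>A linear \<open>k\<close>-graph of maximum degree 2 is dual to a graph \<open>D\<close>: hyperedges are the vertices
  of \<open>D\<close>, and two hyperedges sharing a vertex are adjacent. If every vertex of \<open>D\<close> has degree
  \<open>k - 1\<close> or \<open>k\<close>, then each hyperedge has at most one private vertex, so the hypergraph is
  asymmetric as soon as \<open>D\<close> is rigid. The hyperedges of an asymmetric induced sub-hypergraph
  cannot have two private vertices either, so they span a subgraph of \<open>D\<close> of minimum degree at
  least \<open>k - 1\<close>. Hence if \<open>D\<close> is rigid and all its subgraphs of minimum degree at least \<open>k - 1\<close> have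
  at least \<open>n\<close> vertices, a smallest asymmetric induced sub-hypergraph is minimal asymmetric with at
  least \<open>n\<close> edges.

  With \<open>r = k - 1\<close>, such a \<open>D\<close> arises from a rigid subdivision of \<open>K\<^sub>4\<close> with long cycles (a
  Hamiltonian cycle with two crossing chords) by adding independent vertices of degree \<open>r + 1\<close>, the
  blocks, such that every old vertex lies in \<open>r - 2\<close> blocks. A subgraph of minimum degree \<open>r\<close> then
  has minimum degree 2 on the old vertices. The four branch vertices lie in pairwise different
  blocks, so a block has at most one neighbour of degree \<open>r + 1\<close> while, if there are blocks at all,
  a branch vertex has at least two; therefore automorphisms preserve the set of blocks.\<close>

section \<open>Hypergraphs with a prescribed intersection graph\<close>

text \<open>The transposition of \<open>u\<close> and \<open>v\<close> maps each edge to itself,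
  since an edge contains both of them or neither.\<close>

lemma swap_symmetric:
  assumes "u \<in> verts G" "v \<in> verts G" "u \<noteq> v"
    and same: "\<And>X. X \<in> edges G \<Longrightarrow> u \<in> X \<longleftrightarrow> v \<in> X"
  shows "symmetric G"
proof -
  let ?s = "id(u := v, v := u)"
  have "bij_betw ?s (verts G) (verts G)"
    using assms by (intro bij_betw_byWitness[where f' = ?s]) auto
  moreover have "?s ` X = X" if "X \<in> edges G" for X
    using same[OF that] assms(3) by (cases "u \<in> X") (auto simp: image_iff)
  ultimately have "automorphism G ?s"
    by (simp add: automorphism_def)
  moreover have "?s u \<noteq> u"
    using assms(3) by simp
  ultimately show ?thesis
    using assms(1) unfolding symmetric_def by blast
qed

definition rigid :: "'v set \<Rightarrow> ('v \<Rightarrow> 'v \<Rightarrow> bool) \<Rightarrow> bool" where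
  "rigid N adj \<longleftrightarrow>
     (\<forall>\<psi>. bij_betw \<psi> N N \<and> (\<forall>x\<in>N. \<forall>y\<in>N. adj (\<psi> x) (\<psi> y) \<longleftrightarrow> adj x y) \<longrightarrow> (\<forall>x\<in>N. \<psi> x = x))"

text \<open>Graph vertices index the hyperedges \<open>E x\<close>. \<open>card_meet\<close> encodes
  linearity and makes \<open>adj\<close> the intersection graph, \<open>two_edges\<close> bounds
  degrees by 2, and \<open>private_unique\<close> allows one private vertex per hyperedge.\<close>

locale dual_graph =
  fixes N :: "'v set" and adj :: "'v \<Rightarrow> 'v \<Rightarrow> bool" and E :: "'v \<Rightarrow> 'a set" and k :: nat
  assumes finite_N: "finite N"
    and k_ge: "3 \<le> k"
    and card_E: "\<And>x. x \<in> N \<Longrightarrow> card (E x) = k"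
    and card_meet: "\<And>x y. \<lbrakk>x \<in> N; y \<in> N; x \<noteq> y\<rbrakk> \<Longrightarrow>
          card (E x \<inter> E y) = (if adj x y then 1 else 0)"
    and two_edges: "\<And>e x y z. \<lbrakk>x \<in> N; y \<in> N; z \<in> N; e \<in> E x; e \<in> E y; e \<in> E z\<rbrakk> \<Longrightarrow>
          x = y \<or> y = z \<or> x = z"
    and private_unique: "\<And>e e' x. \<lbrakk>x \<in> N; e \<in> E x; e' \<in> E x;
          \<And>y. \<lbrakk>y \<in> N; y \<noteq> x\<rbrakk> \<Longrightarrow> e \<notin> E y \<and> e' \<notin> E y\<rbrakk> \<Longrightarrow> e = e'"
begin

definition dual :: "'a hypergraph" where
  "dual = (\<Union> (E ` N), E ` N)"

lemma verts_dual: "verts dual = \<Union> (E ` N)"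
  and edges_dual: "edges dual = E ` N"
  by (simp_all add: dual_def)

lemma finite_E: "x \<in> N \<Longrightarrow> finite (E x)"
  using card_E k_ge card.infinite by fastforce

lemma finite_verts: "finite (verts dual)"
  using finite_N finite_E by (auto simp: verts_dual)

lemma meet_le_1: "\<lbrakk>x \<in> N; y \<in> N; x \<noteq> y\<rbrakk> \<Longrightarrow> card (E x \<inter> E y) \<le> 1"
  using card_meet by simp

lemma meet_unique: "\<lbrakk>x \<in> N; y \<in> N; x \<noteq> y; u \<in> E x; u \<in> E y; v \<in> E x; v \<in> E y\<rbrakk> \<Longrightarrow> u = v"
  using meet_le_1[of x y] finite_E[of x] by (auto simp: card_le_Suc0_iff_eq)

lemma adj_iff_meet: "\<lbrakk>x \<in> N; y \<in> N; x \<noteq> y\<rbrakk> \<Longrightarrow> adj x y \<longleftrightarrow> E x \<inter> E y \<noteq> {}"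
  using card_meet[of x y] finite_E[of x] by (auto split: if_splits)

lemma inj_E: "inj_on E N"
proof (rule inj_onI, rule ccontr)
  fix x y assume *: "x \<in> N" "y \<in> N" "E x = E y" "x \<noteq> y"
  then show False
    using meet_le_1[of x y] card_E[of x] k_ge by simp
qed

text \<open>An automorphism permutes the hyperedges and so induces an automorphism of
  \<open>adj\<close>, trivial by rigidity. Hence each hyperedge is mapped to itself, the unique
  common vertex of two hyperedges is fixed, and a moved vertex and its image would be two private
  vertices of one hyperedge.\<close>

lemma asymmetric_dual:
  assumes irrefl: "\<And>x. x \<in> N \<Longrightarrow> \<not> adj x x"
    and rigid: "rigid N adj"
  shows "asymmetric dual"
proof
  assume "symmetric dual"
  then obtain \<phi> v where aut: "automorphism dual \<phi>" and v: "v \<in> verts dual" "\<phi> v \<noteq> v"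
    unfolding symmetric_def by blast
  from aut have inj: "inj_on \<phi> (\<Union> (E ` N))"
    and img: "\<And>x. x \<in> N \<Longrightarrow> \<exists>y\<in>N. \<phi> ` E x = E y"
    by (auto simp: automorphism_def verts_dual edges_dual bij_betw_def image_iff)
  from img obtain \<psi> where \<psi>: "\<And>x. x \<in> N \<Longrightarrow> \<psi> x \<in> N \<and> \<phi> ` E x = E (\<psi> x)"
    by metis
  have "inj_on \<psi> N"
  proof (rule inj_onI)
    fix x y assume *: "x \<in> N" "y \<in> N" "\<psi> x = \<psi> y"
    then have "\<phi> ` E x = \<phi> ` E y"
      using \<psi> by metis
    then have "E x = E y"
      using * by (subst (asm) inj_on_image_eq_iff[OF inj]) auto
    then show "x = y"
      using * inj_E by (auto dest: inj_onD)
  qed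
  then have bij: "bij_betw \<psi> N N"
    using \<psi> finite_N endo_inj_surj[of N \<psi>] by (auto simp: bij_betw_def)
  have adj: "adj (\<psi> x) (\<psi> y) \<longleftrightarrow> adj x y" if xy: "x \<in> N" "y \<in> N" for x y
  proof (cases "x = y")
    case True
    then show ?thesis using irrefl \<psi> xy by auto
  next
    case False
    then have "\<psi> x \<noteq> \<psi> y"
      using \<open>inj_on \<psi> N\<close> xy by (auto dest: inj_onD)
    then have "adj (\<psi> x) (\<psi> y) \<longleftrightarrow> \<phi> ` E x \<inter> \<phi> ` E y \<noteq> {}"
      using \<psi> xy adj_iff_meet[of "\<psi> x" "\<psi> y"] by auto
    also have "\<phi> ` E x \<inter> \<phi> ` E y = \<phi> ` (E x \<inter> E y)"
      using xy by (intro inj_on_image_Int[OF inj, symmetric]) auto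
    finally show ?thesis
      using False xy adj_iff_meet[of x y] by auto
  qed
  have id: "\<phi> ` E x = E x" if "x \<in> N" for x
    using rigid bij adj \<psi> that unfolding rigid_def by metis
  have shared: "\<phi> e = e" if "x \<in> N" "y \<in> N" "x \<noteq> y" "e \<in> E x" "e \<in> E y" for e x y
    using meet_unique[of x y "\<phi> e" e] id that by blast
  from v obtain x where x: "x \<in> N" "v \<in> E x"
    by (auto simp: verts_dual)
  then have \<phi>v: "\<phi> v \<in> E x"
    using id by blast
  \<comment> \<open>A shared vertex is fixed; if \<open>\<phi> v\<close> were shared, injectivity
    would give \<open>\<phi> v = v\<close>.\<close>
  have "\<phi> v \<notin> E y" if "y \<in> N" "y \<noteq> x" for y
  proof
    assume "\<phi> v \<in> E y"
    then have "\<phi> (\<phi> v) = \<phi> v"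
      using shared[of x y "\<phi> v"] that x \<phi>v by blast
    moreover have "\<phi> v \<in> \<Union> (E ` N)" "v \<in> \<Union> (E ` N)"
      using x \<phi>v by auto
    ultimately show False
      using v(2) inj by (auto dest: inj_onD)
  qed
  moreover have "v \<notin> E y" if "y \<in> N" "y \<noteq> x" for y
    using shared[of x y v] v(2) x that by blast
  ultimately show False
    using private_unique[of x "\<phi> v" v] x \<phi>v v(2) by blast
qed

section \<open>Asymmetric induced sub-hypergraphs of the dual\<close>

definition kept :: "'a set \<Rightarrow> 'v set" where
  "kept W = {x \<in> N. E x \<subseteq> W}"

lemma edges_induced: "edges (induced dual W) = E ` kept W"
  by (auto simp: induced_def edges_dual kept_def)

lemma kept_nonempty:
  assumes "2 \<le> card W" "asymmetric (induced dual W)"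
  shows "kept W \<noteq> {}"
proof
  assume empty: "kept W = {}"
  obtain u v where "u \<in> W" "v \<in> W" "u \<noteq> v"
    using assms(1) card_2_iff' obtain_subset_with_card_n[of 2 W] by (metis subsetD)
  then have "symmetric (induced dual W)"
    by (intro swap_symmetric[of u _ v]) (auto simp: edges_induced empty, auto simp: induced_def)
  then show False
    using assms(2) by blast
qed

text \<open>Two vertices of \<open>E x\<close> in no other surviving hyperedge could be swapped, so
  at most one exists. Each of the remaining \<open>k - 1\<close> or more vertices lies in another
  surviving hyperedge, and by linearity different vertices need different hyperedges.\<close>

lemma kept_core:
  assumes "asymmetric (induced dual W)" and x: "x \<in> kept W"
  shows "k - 1 \<le> card {y \<in> kept W. adj x y}"
proof -
  have xN: "x \<in> N" and xW: "E x \<subseteq> W" and fin: "finite (kept W)" "finite (E x)"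
    and keptN: "kept W \<subseteq> N"
    using x finite_N finite_E by (auto simp: kept_def)
  define P where "P = {e \<in> E x. \<forall>y\<in>kept W. y \<noteq> x \<longrightarrow> e \<notin> E y}"
  have "u = v" if "u \<in> P" "v \<in> P" for u v
  proof (rule ccontr)
    assume "u \<noteq> v"
    moreover have "u \<in> E y \<longleftrightarrow> v \<in> E y" if "y \<in> kept W" for y
      using \<open>u \<in> P\<close> \<open>v \<in> P\<close> that by (cases "y = x") (auto simp: P_def)
    ultimately have "symmetric (induced dual W)"
      using that xW
      by (intro swap_symmetric[of u _ v]) (auto simp: edges_induced, auto simp: induced_def P_def)
    then show False
      using assms(1) by blast
  qed
  moreover have "finite P"
    using fin by (simp add: P_def)
  ultimately have P: "card P \<le> 1"
    by (simp add: card_le_Suc0_iff_eq)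
  let ?A = "{y \<in> kept W. adj x y \<and> y \<noteq> x}"
  have "E x - P \<subseteq> (\<Union>y\<in>?A. E x \<inter> E y)"
    using adj_iff_meet[OF xN] keptN by (fastforce simp: P_def)
  then have "card (E x - P) \<le> card (\<Union>y\<in>?A. E x \<inter> E y)"
    using fin by (intro card_mono) auto
  also have "\<dots> \<le> (\<Sum>y\<in>?A. card (E x \<inter> E y))"
    using fin by (intro card_UN_le) auto
  also have "\<dots> \<le> (\<Sum>y\<in>?A. 1)"
    using meet_le_1[OF xN] keptN by (intro sum_mono) auto
  also have "\<dots> = card ?A"
    by simp
  also have "\<dots> \<le> card {y \<in> kept W. adj x y}"
    using fin by (intro card_mono) auto
  finally have "card (E x - P) \<le> card {y \<in> kept W. adj x y}" .
  moreover have "card (E x - P) = k - card P"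
    using fin card_E[OF xN] by (subst card_Diff_subset) (auto simp: P_def)
  ultimately show ?thesis
    using P by linarith
qed

lemma degree_induced_le: "degree (induced dual W) v \<le> 2"
proof -
  let ?X = "{x \<in> kept W. v \<in> E x}"
  have fin: "finite ?X"
    using finite_N by (auto simp: kept_def)
  have "card ?X \<le> 2"
  proof (rule ccontr)
    assume "\<not> card ?X \<le> 2"
    then obtain Y where "Y \<subseteq> ?X" "card Y = 3"
      using obtain_subset_with_card_n[of 3 ?X] by auto
    then obtain x y z where "{x, y, z} \<subseteq> ?X" "x \<noteq> y" "y \<noteq> z" "x \<noteq> z"
      by (auto simp: card_3_iff)
    then show False
      using two_edges[of x y z v] by (auto simp: kept_def)
  qed
  moreover have "{X \<in> edges (induced dual W). v \<in> X} = E ` ?X"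
    by (auto simp: edges_induced)
  ultimately show ?thesis
    using card_image_le[OF fin, of E] unfolding degree_def by simp
qed

lemma codegree_induced_le:
  assumes "u \<noteq> v"
  shows "codegree (induced dual W) u v \<le> 1"
proof -
  have "X = Y" if "X \<in> edges (induced dual W)" "Y \<in> edges (induced dual W)"
    "u \<in> X" "v \<in> X" "u \<in> Y" "v \<in> Y" for X Y
    using that meet_unique assms by (auto simp: edges_induced kept_def)
  moreover have "finite (edges (induced dual W))"
    using finite_N by (auto simp: edges_induced kept_def)
  ultimately show ?thesis
    unfolding codegree_def One_nat_def by (subst card_le_Suc0_iff_eq) auto
qed

text \<open>The bound 2 is attained at the common vertex of two surviving hyperedges;
  \<open>kept_core\<close> provides an adjacent pair.\<close>

lemma max_degree_induced:
  assumes "2 \<le> card W" "asymmetric (induced dual W)"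
    and irrefl: "\<And>x. x \<in> N \<Longrightarrow> \<not> adj x x"
  shows "max_degree (induced dual W) = 2"
proof -
  obtain x where x: "x \<in> kept W"
    using kept_nonempty[OF assms(1,2)] by blast
  have "{y \<in> kept W. adj x y} \<noteq> {}"
    using kept_core[OF assms(2) x] k_ge by (auto simp del: Collect_empty_eq)
  then obtain y where y: "y \<in> kept W" "adj x y"
    by blast
  have N: "x \<in> N" "y \<in> N" "x \<noteq> y"
    using x y irrefl by (auto simp: kept_def)
  then obtain e where e: "e \<in> E x" "e \<in> E y"
    using adj_iff_meet[of x y] y by blast
  have "E x \<noteq> E y"
    using N inj_E by (auto dest: inj_onD)
  then have "2 = card {E x, E y}"
    by simp
  also have "\<dots> \<le> degree (induced dual W) e"
    unfolding degree_def using x y e finite_N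
    by (intro card_mono) (auto simp: edges_induced kept_def)
  finally have "degree (induced dual W) e = 2"
    using degree_induced_le[of W e] by linarith
  moreover have "e \<in> W"
    using e x by (auto simp: kept_def)
  ultimately show ?thesis
    unfolding max_degree_def using degree_induced_le[of W]
    by (intro cSup_eq_maximum) (auto simp: induced_def intro!: exI[of _ e])
qed

lemma max_codegree_induced:
  assumes "2 \<le> card W" "asymmetric (induced dual W)"
  shows "max_codegree (induced dual W) = 1"
proof -
  obtain x where x: "x \<in> kept W"
    using kept_nonempty[OF assms] by blast
  then have "\<not> card (E x) \<le> Suc 0"
    using card_E[of x] k_ge by (auto simp: kept_def)
  then obtain u v where uv: "u \<in> E x" "v \<in> E x" "u \<noteq> v"
    using x finite_E[of x] by (auto simp: card_le_Suc0_iff_eq kept_def)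
  have "1 = card {E x}"
    by simp
  also have "\<dots> \<le> codegree (induced dual W) u v"
    unfolding codegree_def using x uv finite_N
    by (intro card_mono) (auto simp: edges_induced kept_def)
  finally have "codegree (induced dual W) u v = 1"
    using codegree_induced_le[OF uv(3), of W] by linarith
  moreover have "u \<in> W" "v \<in> W"
    using uv x by (auto simp: kept_def)
  ultimately show ?thesis
    unfolding max_codegree_def using codegree_induced_le[of _ _ W] uv(3)
    by (intro cSup_eq_maximum) (auto 0 0 simp: induced_def, metis)
qed

text \<open>The witness is induced by a vertex set \<open>W\<close> of least cardinality among those
  with at least two elements and an asymmetric induced sub-hypergraph. By \<open>kept_core\<close>
  the hypothesis \<open>core\<close> applies to \<open>kept W\<close> and bounds the number of
  edges.\<close>

lemma minimal_asymmetric_induced: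
  assumes irrefl: "\<And>x. x \<in> N \<Longrightarrow> \<not> adj x x"
    and rigid: "rigid N adj"
    and core: "\<And>F. \<lbrakk>F \<subseteq> N; F \<noteq> {}; \<And>x. x \<in> F \<Longrightarrow> k - 1 \<le> card {y \<in> F. adj x y}\<rbrakk> \<Longrightarrow> n \<le> card F"
    and ne: "N \<noteq> {}"
  shows "\<exists>G :: 'a hypergraph. k_graph k G \<and> minimal_asymmetric G \<and>
           max_degree G = 2 \<and> max_codegree G = 1 \<and> n \<le> card (edges G)"
proof -
  let ?Q = "\<lambda>W. W \<subseteq> verts dual \<and> 2 \<le> card W \<and> asymmetric (induced dual W)"
  have full: "induced dual (verts dual) = dual"
    by (auto simp: induced_def dual_def)
  obtain x where x: "x \<in> N"
    using ne by blast
  have "card (E x) \<le> card (verts dual)"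
    using finite_verts x by (intro card_mono) (auto simp: verts_dual)
  then have "?Q (verts dual)"
    using asymmetric_dual[OF irrefl rigid] full card_E[OF x] k_ge by simp
  then obtain W where W: "?Q W" and least: "\<And>W'. ?Q W' \<Longrightarrow> card W \<le> card W'"
    using ex_has_least_nat[of ?Q "verts dual" card] by blast
  let ?G = "induced dual W"
  have verts: "verts ?G = W"
    by (simp add: induced_def)
  have "k_graph k ?G"
    using W finite_verts k_ge card_E
    by (auto simp: k_graph_def verts edges_induced kept_def intro: finite_subset)
  moreover have "minimal_asymmetric ?G"
    unfolding minimal_asymmetric_def verts
  proof (intro conjI allI impI)
    show "asymmetric ?G" using W by blast
    fix W' assume W': "W' \<subseteq> W" "2 \<le> card W' \<and> card W' < card W"
    \<comment> \<open>Inducing twice is inducing once, so the choice of \<open>W\<close> covers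
      sub-hypergraphs of \<open>?G\<close>.\<close>
    have "induced ?G W' = induced dual W'"
      using W' by (auto simp: induced_def)
    then show "symmetric (induced ?G W')"
      using least[of W'] W W' by fastforce
  qed
  moreover have "n \<le> card (kept W)"
    using kept_nonempty kept_core W by (intro core) (auto simp: kept_def)
  then have "n \<le> card (edges ?G)"
    using inj_E by (auto simp: edges_induced card_image inj_on_subset kept_def)
  ultimately show ?thesis
    using max_degree_induced max_codegree_induced irrefl W by blast
qed

end

section \<open>Realising a graph as an intersection graph\<close>

lemma minimal_asymmetric_from_graph:
  fixes N :: "'v set"
  assumes "finite N" "N \<noteq> {}" "3 \<le> k"
    and sym: "\<And>x y. adj x y \<Longrightarrow> adj y x"
    and irrefl: "\<And>x. \<not> adj x x"
    and deg: "\<And>x. x \<in> N \<Longrightarrow> card {y \<in> N. adj x y} = k - 1 \<or> card {y \<in> N. adj x y} = k"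
    and rigid: "rigid N adj"
    and core: "\<And>F. \<lbrakk>F \<subseteq> N; F \<noteq> {}; \<And>x. x \<in> F \<Longrightarrow> k - 1 \<le> card {y \<in> F. adj x y}\<rbrakk> \<Longrightarrow> n \<le> card F"
  shows "\<exists>G :: nat hypergraph. k_graph k G \<and> minimal_asymmetric G \<and>
           max_degree G = 2 \<and> max_codegree G = 1 \<and> n \<le> card (edges G)"
proof -
  define nb where "nb x = {y \<in> N. adj x y}" for x
  \<comment> \<open>An edge of the graph becomes a vertex lying in two hyperedges; a graph vertex
    \<open>x\<close> of degree \<open>k - 1\<close> is topped up with the private vertex \<open>{x}\<close>.\<close>
  define I where "I x = (\<lambda>y. {x, y}) ` (nb x \<union> (if card (nb x) = k - 1 then {x} else {}))" for x
  have finnb: "finite (nb x)" for x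
    using assms(1) by (simp add: nb_def)
  have x_nb: "x \<notin> nb x" for x
    using irrefl by (simp add: nb_def)
  have finI: "finite (I x)" for x
    using finnb by (simp add: I_def)
  \<comment> \<open>The hyperedges \<open>I x\<close> consist of sets of graph vertices;
    \<open>f\<close> renames these sets to natural numbers.\<close>
  obtain f :: "'v set \<Rightarrow> nat" where f: "inj_on f (\<Union> (I ` N))"
    using finite_imp_inj_to_nat_seg[of "\<Union> (I ` N)"] finI assms(1) by auto
  have cardI: "card (I x) = k" if "x \<in> N" for x
  proof -
    have "inj_on (\<lambda>y. {x, y}) UNIV"
      by (auto simp: inj_on_def doubleton_eq_iff)
    then have "card (I x) = card (nb x \<union> (if card (nb x) = k - 1 then {x} else {}))"
      unfolding I_def by (intro card_image) (auto intro: inj_on_subset)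
    also have "\<dots> = k"
      using deg[OF that] finnb x_nb[of x] assms(3) by (auto simp: nb_def[symmetric])
    finally show ?thesis .
  qed
  have sub: "e \<in> I x \<Longrightarrow> x \<in> e \<and> e \<noteq> {}" for e x
    by (auto simp: I_def)
  have pair: "e \<in> I x \<Longrightarrow> e \<in> I y \<Longrightarrow> x \<noteq> y \<Longrightarrow> e = {x, y} \<and> adj x y" for e x y
    using sym by (auto simp: I_def nb_def split: if_splits)
  have pairI: "x \<in> N \<Longrightarrow> y \<in> N \<Longrightarrow> adj x y \<Longrightarrow> {x, y} \<in> I x \<and> {x, y} \<in> I y" for x y
    using sym[of x y] by (auto simp: I_def nb_def insert_commute)
  have meet: "I x \<inter> I y = (if adj x y then {{x, y}} else {})" if "x \<in> N" "y \<in> N" "x \<noteq> y" for x y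
    using pair[of _ x y] pairI[of x y] that by auto
  have mem: "f e \<in> f ` I x \<longleftrightarrow> e \<in> I x" if "e \<in> I y" "x \<in> N" "y \<in> N" for e x y
    using that by (intro inj_on_image_mem_iff[OF f]) auto
  interpret dual_graph N adj "\<lambda>x. f ` I x" k
  proof
    fix x assume x: "x \<in> N"
    show "card (f ` I x) = k"
      using x f cardI[OF x] by (subst card_image) (auto intro: inj_on_subset)
  next
    fix x y assume xy: "x \<in> N" "y \<in> N" "x \<noteq> y"
    have "f ` I x \<inter> f ` I y = f ` (I x \<inter> I y)"
      using xy by (intro inj_on_image_Int[OF f, symmetric]) auto
    then show "card (f ` I x \<inter> f ` I y) = (if adj x y then 1 else 0)"
      using meet[OF xy] by simp
  next
    fix e x y z
    assume *: "x \<in> N" "y \<in> N" "z \<in> N" "e \<in> f ` I x" "e \<in> f ` I y" "e \<in> f ` I z"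
    then obtain e' where e': "e = f e'" "e' \<in> I x" by blast
    then have "e' \<in> I y" "e' \<in> I z"
      using mem[of e' x y] mem[of e' x z] * by auto
    then show "x = y \<or> y = z \<or> x = z"
      using pair[of e' x y] sub[of e' z] e' by fastforce
  next
    fix e e' x
    assume *: "x \<in> N" "e \<in> f ` I x" "e' \<in> f ` I x"
      "\<And>y. \<lbrakk>y \<in> N; y \<noteq> x\<rbrakk> \<Longrightarrow> e \<notin> f ` I y \<and> e' \<notin> f ` I y"
    have "d = {x}" if d: "d \<in> I x" and priv: "\<And>y. \<lbrakk>y \<in> N; y \<noteq> x\<rbrakk> \<Longrightarrow> f d \<notin> f ` I y" for d
    proof (rule ccontr)
      assume "d \<noteq> {x}"
      then obtain y where y: "y \<in> N" "adj x y" "d = {x, y}"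
        using d by (auto simp: I_def nb_def split: if_splits)
      then have "y \<noteq> x" "d \<in> I y"
        using irrefl pairI[of x y] *(1) by auto
      then show False
        using priv[of y] y by blast
    qed
    then show "e = e'"
      using * by (metis image_iff)
  qed (use assms in auto)
  show ?thesis
    using minimal_asymmetric_induced irrefl rigid core assms(2) by blast
qed

section \<open>A rigid graph without small dense parts\<close>

text \<open>The cycle has length \<open>N\<close>. Since \<open>9 * L \<le> N\<close>, the arc from
  \<open>2 * L\<close> on to 0 is far longer than the arc from 1 to \<open>L\<close>, with which a
  reversal of the chords would exchange it.\<close>

locale chorded_cycle =
  fixes L N :: nat
  assumes L_ge: "4 \<le> L" and N_ge: "9 * L \<le> N"
begin

text \<open>The clauses for consecutive numbers are not bounded by \<open>N\<close>, so this is the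
  cycle with crossing chords only on \<open>{..<N}\<close>, where all neighbourhoods are
  taken.\<close>

definition C :: "nat \<Rightarrow> nat \<Rightarrow> bool" where
  "C p q \<longleftrightarrow> q = p + 1 \<or> p = q + 1 \<or> {p, q} = {0, N - 1} \<or> {p, q} = {0, L} \<or> {p, q} = {1, 2 * L}"

definition S :: "nat set" where
  "S = {0, 1, L, 2 * L}"

lemma C_sym: "C p q \<longleftrightarrow> C q p"
  unfolding C_def by (auto simp: doubleton_eq_iff)

lemma C_irrefl: "\<not> C p p"
  using L_ge N_ge unfolding C_def by (auto simp: doubleton_eq_iff)

lemma S_less: "p \<in> S \<Longrightarrow> p < 3 * L"
  using L_ge by (auto simp: S_def)

lemma nb_0: "q < N \<Longrightarrow> C 0 q \<longleftrightarrow> q \<in> {1, N - 1, L}"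
  using L_ge N_ge by (auto simp: C_def doubleton_eq_iff)

lemma nb_1: "q < N \<Longrightarrow> C 1 q \<longleftrightarrow> q \<in> {0, 2, 2 * L}"
  using L_ge N_ge by (auto simp: C_def doubleton_eq_iff)

lemma nb_L: "q < N \<Longrightarrow> C L q \<longleftrightarrow> q \<in> {0, L - 1, L + 1}"
  using L_ge N_ge by (auto simp: C_def doubleton_eq_iff)

lemma nb_2L: "q < N \<Longrightarrow> C (2 * L) q \<longleftrightarrow> q \<in> {1, 2 * L - 1, 2 * L + 1}"
  using L_ge N_ge by (auto simp: C_def doubleton_eq_iff)

text \<open>Outside \<open>S\<close> only the cycle contributes. As 0 lies in \<open>S\<close>,
  \<open>p - 1\<close> is a true predecessor; the conditional handles the wrap-around.\<close>

lemma nb_generic: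
  "\<lbrakk>p < N; q < N; p \<notin> S\<rbrakk> \<Longrightarrow> C p q \<longleftrightarrow> q \<in> {p - 1, if p = N - 1 then 0 else p + 1}"
  using L_ge N_ge by (auto simp: C_def S_def doubleton_eq_iff)

lemma nb_sets:
  "{q. q < N \<and> C 0 q} = {1, N - 1, L}"
  "{q. q < N \<and> C 1 q} = {0, 2, 2 * L}"
  "{q. q < N \<and> C L q} = {0, L - 1, L + 1}"
  "{q. q < N \<and> C (2 * L) q} = {1, 2 * L - 1, 2 * L + 1}"
  "\<lbrakk>p < N; p \<notin> S\<rbrakk> \<Longrightarrow> {q. q < N \<and> C p q} = {p - 1, if p = N - 1 then 0 else p + 1}"
proof -
  show "{q. q < N \<and> C 0 q} = {1, N - 1, L}"
    using nb_0 L_ge N_ge by auto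
  show "{q. q < N \<and> C 1 q} = {0, 2, 2 * L}"
    using nb_1 L_ge N_ge by auto
  show "{q. q < N \<and> C L q} = {0, L - 1, L + 1}"
    using nb_L L_ge N_ge by auto
  show "{q. q < N \<and> C (2 * L) q} = {1, 2 * L - 1, 2 * L + 1}"
    using nb_2L L_ge N_ge by auto
  show "{q. q < N \<and> C p q} = {p - 1, if p = N - 1 then 0 else p + 1}" if "p < N" "p \<notin> S"
    using nb_generic[OF that(1) _ that(2)] that L_ge N_ge by auto
qed

lemma degree_C:
  assumes "p < N"
  shows "card {q. q < N \<and> C p q} = (if p \<in> S then 3 else 2)"
proof (cases "p \<in> S")
  case True
  have card_3: "card {a, b, c} = 3" if "a \<noteq> b" "b \<noteq> c" "a \<noteq> c" for a b c :: nat
    using that by simp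
  from True consider "p = 0" | "p = 1" | "p = L" | "p = 2 * L"
    by (auto simp: S_def)
  then have "card {q. q < N \<and> C p q} = 3"
  proof cases
    case 1
    show ?thesis
      unfolding 1 nb_sets using L_ge N_ge by (intro card_3) linarith+
  next
    case 2
    show ?thesis
      unfolding 2 nb_sets using L_ge N_ge by (intro card_3) linarith+
  next
    case 3
    show ?thesis
      unfolding 3 nb_sets using L_ge N_ge by (intro card_3) linarith+
  next
    case 4
    show ?thesis
      unfolding 4 nb_sets using L_ge N_ge by (intro card_3) linarith+
  qed
  then show ?thesis using True by simp
next
  case False
  \<comment> \<open>With \<open>p\<close> at least 2, the predecessor is positive and differs from
    the wrap-around neighbour 0.\<close>
  then have "p \<noteq> 0" "p \<noteq> 1"
    by (auto simp: S_def)
  then have "p - 1 \<noteq> (if p = N - 1 then 0 else p + 1)"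
    by auto
  then show ?thesis
    using False by (simp add: nb_sets(5)[OF assms False])
qed

lemma nb_on_S:
  assumes "p \<in> S"
  shows "C 0 p \<longleftrightarrow> p = 1 \<or> p = L" "C 1 p \<longleftrightarrow> p = 0 \<or> p = 2 * L"
    "C L p \<longleftrightarrow> p = 0" "C (2 * L) p \<longleftrightarrow> p = 1"
proof -
  have "p < N"
    using S_less[OF assms] N_ge by simp
  note nb = nb_0[OF this] nb_1[OF this] nb_L[OF this] nb_2L[OF this]
  from assms consider "p = 0" | "p = 1" | "p = L" | "p = 2 * L"
    by (auto simp: S_def)
  then show "C 0 p \<longleftrightarrow> p = 1 \<or> p = L" "C 1 p \<longleftrightarrow> p = 0 \<or> p = 2 * L"
    "C L p \<longleftrightarrow> p = 0" "C (2 * L) p \<longleftrightarrow> p = 1"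
    unfolding nb using L_ge N_ge by (cases; simp)+
qed

text \<open>On \<open>S\<close> the graph is the path \<open>L - 0 - 1 - 2 L\<close>, whose only nontrivial automorphism is
  the reversal.\<close>

lemma S_path:
  assumes "a \<in> S" "b \<in> S" "c \<in> S" "d \<in> S" "C a b" "C a c" "C b d" "b \<noteq> c" "a \<noteq> d"
  shows "(a = 0 \<and> b = 1 \<and> c = L \<and> d = 2 * L) \<or> (a = 1 \<and> b = 0 \<and> c = 2 * L \<and> d = L)"
proof -
  note nb = nb_on_S[OF assms(2)] nb_on_S[OF assms(3)] nb_on_S[OF assms(4)]
  from assms(1) consider "a = 0" | "a = 1" | "a = L" | "a = 2 * L"
    by (auto simp: S_def)
  then show ?thesis
  proof cases
    case 1
    then have "b = 1" "c = L" using assms nb by auto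
    then show ?thesis using 1 assms nb by auto
  next
    case 2
    then have "b = 0" "c = 2 * L" using assms nb by auto
    then show ?thesis using 2 assms nb by auto
  next
    case 3
    then show ?thesis using assms nb by simp
  next
    case 4
    then show ?thesis using assms nb by simp
  qed
qed

text \<open>An automorphism preserves degrees, hence \<open>S\<close>, and acts on the path spanned
  by \<open>S\<close> as the identity or the reversal. The identity propagates around the cycle; the
  reversal contradicts the arc lengths.\<close>

lemma C_rigid:
  assumes inj: "inj_on \<theta> {..<N}" and lt: "\<And>p. p < N \<Longrightarrow> \<theta> p < N"
    and C: "\<And>p q. \<lbrakk>p < N; q < N\<rbrakk> \<Longrightarrow> C (\<theta> p) (\<theta> q) \<longleftrightarrow> C p q"
    and p: "p < N"
  shows "\<theta> p = p"
proof -
  have eq: "\<theta> p = \<theta> q \<longleftrightarrow> p = q" if "p < N" "q < N" for p q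
    using inj that by (auto dest: inj_onD)
  have onto: "\<theta> ` {..<N} = {..<N}"
    using inj lt by (intro endo_inj_surj) auto
  have deg: "\<theta> p \<in> S \<longleftrightarrow> p \<in> S" if "p < N" for p
  proof -
    have "{q. q < N \<and> C (\<theta> p) q} = \<theta> ` {q. q < N \<and> C p q}"
    proof (intro equalityI subsetI)
      fix q assume q: "q \<in> {q. q < N \<and> C (\<theta> p) q}"
      then obtain q' where "q' < N" "q = \<theta> q'"
        using onto by (metis (no_types, lifting) imageE lessThan_iff mem_Collect_eq)
      then show "q \<in> \<theta> ` {q. q < N \<and> C p q}"
        using q C that by auto
    qed (use C lt that in auto)
    then have "card {q. q < N \<and> C (\<theta> p) q} = card {q. q < N \<and> C p q}"
      using inj by (auto intro!: card_image inj_on_subset[OF inj])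
    then show ?thesis
      using degree_C[OF that] degree_C[OF lt[OF that]] by (auto split: if_splits)
  qed
  have SN: "0 < N" "1 < N" "L < N" "2 * L < N"
    using L_ge N_ge by auto
  have S: "\<theta> 0 \<in> S" "\<theta> 1 \<in> S" "\<theta> L \<in> S" "\<theta> (2 * L) \<in> S"
    using deg SN by (auto simp: S_def)
  have C': "C (\<theta> 0) (\<theta> 1)" "C (\<theta> 0) (\<theta> L)" "C (\<theta> 1) (\<theta> (2 * L))"
    using C SN by (auto simp: C_def)
  have dist: "\<theta> 1 \<noteq> \<theta> L" "\<theta> 0 \<noteq> \<theta> (2 * L)"
    using eq SN L_ge by auto
  have "(\<theta> 0 = 0 \<and> \<theta> 1 = 1 \<and> \<theta> L = L \<and> \<theta> (2 * L) = 2 * L) \<or>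
        (\<theta> 0 = 1 \<and> \<theta> 1 = 0 \<and> \<theta> L = 2 * L \<and> \<theta> (2 * L) = L)"
    by (rule S_path[OF S C' dist])
  then show ?thesis
  proof (elim disjE conjE)
    assume fixed: "\<theta> 0 = 0" "\<theta> 1 = 1" "\<theta> L = L" "\<theta> (2 * L) = 2 * L"
    show ?thesis
      using p
    proof (induction p rule: less_induct)
      case (less p)
      show ?case
      proof (cases "p \<in> S")
        case True
        then show ?thesis using fixed by (auto simp: S_def)
      next
        case False
        then have p: "2 \<le> p"
          by (auto simp: S_def)
        have prev: "\<theta> (p - 1) = p - 1" "\<theta> (p - 2) = p - 2"
          using less p by auto
        have "C (\<theta> (p - 1)) (\<theta> p)"
          using C[of "p - 1" p] less.prems p by (simp add: C_def)
        then have adj: "C (p - 1) (\<theta> p)"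
          using prev by simp
        \<comment> \<open>These values are already taken, which leaves \<open>p\<close> as the only
          possible neighbour of \<open>p - 1\<close>.\<close>
        have ne: "\<theta> p \<noteq> p - 2" "\<theta> p \<noteq> 0" "\<theta> p \<noteq> 1" "\<theta> p \<noteq> L" "\<theta> p \<noteq> 2 * L"
          using eq[of p "p - 2"] eq[of p 0] eq[of p 1] eq[of p L] eq[of p "2 * L"]
            less.prems SN fixed prev p False by (auto simp: S_def)
        show ?thesis
        proof (cases "p - 1 \<in> S")
          case True
          then consider "p = 2" | "p = L + 1" | "p = 2 * L + 1"
            using p by (auto simp: S_def)
          then show ?thesis
          proof cases
            case 1
            then show ?thesis using adj ne nb_1[of "\<theta> p"] lt[of p] less.prems by auto
          next
            case 2
            then show ?thesis using adj ne nb_L[of "\<theta> p"] lt[of p] less.prems by auto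
          next
            case 3
            then show ?thesis using adj ne nb_2L[of "\<theta> p"] lt[of p] less.prems by auto
          qed
        next
          case False
          moreover have "p - 1 \<noteq> N - 1" "p - 1 - 1 = p - 2" "p - 1 + 1 = p" "p - 1 < N"
            using less.prems p by auto
          ultimately show ?thesis
            using adj ne(1) nb_generic[of "p - 1" "\<theta> p"] lt[of p] less.prems by simp
        qed
      qed
    qed
  next
    assume rev: "\<theta> 0 = 1" "\<theta> 1 = 0" "\<theta> L = 2 * L" "\<theta> (2 * L) = L"
    \<comment> \<open>Walking up from 1 towards \<open>L\<close>, the images walk down the cycle
      from 0 through \<open>N - 1\<close>. So \<open>L\<close> would go to \<open>N + 1 - L\<close>,
      which is larger than \<open>2 * L\<close>.\<close>
    have "p \<le> L \<Longrightarrow> 2 \<le> p \<Longrightarrow> \<theta> p = N + 1 - p" for p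
    proof (induction p rule: less_induct)
      case (less p)
      have pN: "p < N"
        using less.prems SN by simp
      have adj: "C (\<theta> (p - 1)) (\<theta> p)"
        using C[of "p - 1" p] less.prems pN by (simp add: C_def)
      show ?case
      proof (cases "p = 2")
        case True
        have "\<theta> p \<noteq> 1" "\<theta> p \<noteq> L"
          using eq[of p 0] eq[of p "2 * L"] True SN rev L_ge pN by auto
        then show ?thesis
          using adj nb_0[of "\<theta> p"] lt[OF pN] True rev by auto
      next
        case False
        then have prev: "\<theta> (p - 1) = N + 2 - p"
          using less.IH[of "p - 1"] less.prems by auto
        have "\<theta> p \<noteq> \<theta> (p - 2)"
          using eq[of p "p - 2"] less.prems pN by auto
        \<comment> \<open>For \<open>p = 3\<close> the wrap-around shows: the cyclic successor of
          \<open>N - 1\<close> is 0 instead of \<open>N\<close>.\<close>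
        moreover have "\<theta> (p - 2) = (if p = 3 then 0 else N + 3 - p)"
          using less.IH[of "p - 2"] less.prems False rev by (auto simp: numeral_eq_Suc)
        moreover have "N + 2 - p < N" "N + 2 - p \<notin> S"
          using less.prems False N_ge L_ge by (auto simp: S_def)
        then have "\<theta> p = N + 2 - p - 1 \<or> \<theta> p = (if N + 2 - p = N - 1 then 0 else N + 2 - p + 1)"
          using adj prev nb_generic[of "N + 2 - p" "\<theta> p"] lt[OF pN] by auto
        moreover have "N + 2 - p = N - 1 \<longleftrightarrow> p = 3" "N + 2 - p - 1 = N + 1 - p"
          "N + 2 - p + 1 = N + 3 - p"
          using less.prems False pN by auto
        ultimately show ?thesis
          by (cases "p = 3") simp_all
      qed
    qed
    from this[of L] have "\<theta> L = N + 1 - L"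
      using L_ge by simp
    then show ?thesis
      using rev N_ge L_ge by simp
  qed
qed

text \<open>Minimum degree 2 forces both neighbours of a non-branch vertex into \<open>F\<close>,
  hence the whole open arc between branch vertices around it. Each such nonempty arc has at least
  \<open>L - 2\<close> vertices.\<close>

lemma C_core:
  assumes F: "F \<subseteq> {..<N}" "F \<noteq> {}" and deg: "\<And>p. p \<in> F \<Longrightarrow> 2 \<le> card {q \<in> F. C p q}"
  shows "L - 2 \<le> card F"
proof -
  have fin: "finite F"
    using F finite_subset by blast
  have few: False if "p \<in> F" "{q \<in> F. C p q} \<subseteq> {q}" for p q
    using deg[OF that(1)] card_mono[OF _ that(2)] by simp
  have nbs: "p - 1 \<in> F \<and> (p + 1 < N \<longrightarrow> p + 1 \<in> F)" if "p \<in> F" "p \<notin> S" for p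
  proof -
    have "p < N"
      using that F by auto
    have nb: "C p q \<longleftrightarrow> q \<in> {p - 1, if p = N - 1 then 0 else p + 1}" if "q \<in> F" for q
      using nb_generic[OF \<open>p < N\<close> _ \<open>p \<notin> S\<close>, of q] that F(1) by blast
    have "p + 1 \<in> F" if "p + 1 < N"
    proof (rule ccontr)
      assume "p + 1 \<notin> F"
      moreover have "p \<noteq> N - 1"
        using that by simp
      ultimately have "{q \<in> F. C p q} \<subseteq> {p - 1}"
        using nb by auto
      then show False
        by (rule few[OF \<open>p \<in> F\<close>])
    qed
    moreover have "p - 1 \<in> F"
    proof (rule ccontr)
      assume "p - 1 \<notin> F"
      then have "{q \<in> F. C p q} \<subseteq> {if p = N - 1 then 0 else p + 1}"
        using nb by auto
      then show False
        by (rule few[OF \<open>p \<in> F\<close>])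
    qed
    ultimately show ?thesis by blast
  qed
  have arc: "{a<..<b} \<subseteq> F" if "p \<in> F" "a < p" "p < b" "b \<le> N" "{a<..<b} \<inter> S = {}" for p a b
  proof
    fix q assume q: "q \<in> {a<..<b}"
    show "q \<in> F"
    proof (cases "p \<le> q")
      case True
      then show ?thesis
        using q
      proof (induction q rule: dec_induct)
        case (step n)
        then have "n \<in> {a<..<b}" "n \<in> F" "n + 1 < N"
          using that by auto
        moreover from this have "n \<notin> S"
          using that by blast
        ultimately show ?case
          using nbs[of n] by auto
      qed (use that in simp)
    next
      case False
      then have "q \<le> p" by simp
      then show ?thesis
        using q
      proof (induction q rule: inc_induct)
        case (step n)
        then have "Suc n \<in> {a<..<b}" "Suc n \<in> F"
          using that by auto
        moreover from this have "Suc n \<notin> S"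
          using that by blast
        ultimately show ?case
          using nbs[of "Suc n"] by auto
      qed (use that in simp)
    qed
  qed
  \<comment> \<open>\<open>S\<close> spans a path, which is peeled off from its ends: first
    \<open>L\<close> and \<open>2 * L\<close>, then 0 and 1.\<close>
  have "\<not> F \<subseteq> S"
  proof
    assume FS: "F \<subseteq> S"
    note nb = nb_on_S[OF subsetD[OF FS]]
    have L: "L \<notin> F"
      using few[of L 0] nb(3) by blast
    moreover have L2: "2 * L \<notin> F"
      using few[of "2 * L" 1] nb(4) by blast
    moreover have "0 \<notin> F"
      using few[of 0 1] nb(1) L by blast
    moreover have "1 \<notin> F"
      using few[of 1 0] nb(2) L2 by blast
    moreover obtain x where "x \<in> F"
      using F(2) by blast
    moreover from this have "x = 0 \<or> x = 1 \<or> x = L \<or> x = 2 * L"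
      using subsetD[OF FS] unfolding S_def by blast
    ultimately show False
      by blast
  qed
  then obtain p where p: "p \<in> F" "p \<notin> S"
    by blast
  have "p < N"
    using p F by auto
  moreover have "p \<noteq> 0" "p \<noteq> 1" "p \<noteq> L" "p \<noteq> 2 * L"
    using p(2) by (simp_all add: S_def)
  ultimately have cases: "1 < p \<and> p < L \<or> L < p \<and> p < 2 * L \<or> 2 * L < p \<and> p < N"
    by linarith
  \<comment> \<open>The last arc closes up at 0, for which \<open>N\<close> stands in as right
    end.\<close>
  have gaps: "{1<..<L} \<inter> S = {}" "{L<..<2 * L} \<inter> S = {}" "{2 * L<..<N} \<inter> S = {}"
    using L_ge by (auto simp: S_def)
  have lens: "1 + L - 1 \<le> L" "L + L - 1 \<le> 2 * L" "2 * L + L - 1 \<le> N" "L \<le> N" "2 * L \<le> N"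
    using N_ge by linarith+
  from cases gaps lens obtain a b
    where "a < p" "p < b" "b \<le> N" "{a<..<b} \<inter> S = {}" "a + L - 1 \<le> b"
    by blast
  then have "{a<..<b} \<subseteq> F" "L - 2 \<le> b - Suc a"
    using arc[OF p(1)] by simp_all
  then show ?thesis
    using card_mono[OF fin, of "{a<..<b}"] by simp
qed

end

section \<open>Adding blocks to the chorded cycle\<close>

lemma mod_add_cancel:
  fixes p q a m :: nat
  assumes "(p + a) mod m = (q + a) mod m"
  shows "p mod m = q mod m"
proof -
  obtain x y where "p + a + m * x = q + a + m * y"
    using assms nat_mod_eq_iff by blast
  then have "p + m * x = q + m * y"
    by simp
  then show ?thesis
    using nat_mod_eq_iff by blast
qed

locale block_graph =
  fixes r L :: nat
  assumes r_ge: "2 \<le> r" and L_ge_r: "r + 2 \<le> L"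
begin

text \<open>With rows of length \<open>3 * L\<close>, row 0 contains all of \<open>S\<close>, so a
  block contains at most one branch vertex.\<close>

definition M :: nat where "M = 3 * L"
definition N :: nat where "N = M * (r + 1)"
definition B :: "(nat \<times> nat) set" where "B = {..<r - 2} \<times> {..<M}"

text \<open>Arrange \<open>{..<N}\<close> in \<open>r + 1\<close> rows of length \<open>M\<close>. The block \<open>(j, c)\<close> is a line of slope \<open>- j\<close>:
  it meets every row once, and for fixed \<open>j\<close> the blocks partition \<open>{..<N}\<close>.\<close>

definition in_block :: "nat \<Rightarrow> nat \<times> nat \<Rightarrow> bool" where
  "in_block p b \<longleftrightarrow> (p + fst b * (p div M)) mod M = snd b"

sublocale chorded_cycle L N
proof
  show "4 \<le> L" using r_ge L_ge_r by simp
  have "3 * L * 3 \<le> N"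
    unfolding N_def M_def using r_ge by (intro mult_le_mono) auto
  then show "9 * L \<le> N" by simp
qed

fun adj :: "nat + nat \<times> nat \<Rightarrow> nat + nat \<times> nat \<Rightarrow> bool" where
  "adj (Inl p) (Inl q) = C p q"
| "adj (Inl p) (Inr b) = in_block p b"
| "adj (Inr b) (Inl p) = in_block p b"
| "adj (Inr b) (Inr b') = False"

definition V :: "(nat + nat \<times> nat) set" where
  "V = Inl ` {..<N} \<union> Inr ` B"

lemma M_pos: "0 < M" and r_le_M: "r \<le> M"
  using L_ge_r by (simp_all add: M_def)

lemma V_simps [simp]: "Inl p \<in> V \<longleftrightarrow> p < N" "Inr b \<in> V \<longleftrightarrow> b \<in> B"
  by (auto simp: V_def)

lemma finite_V: "finite V"
  by (simp add: V_def B_def)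

lemma adj_sym: "adj x y \<Longrightarrow> adj y x"
  by (cases x; cases y) (auto simp: C_sym)

lemma adj_irrefl: "\<not> adj x x"
  by (cases x) (auto simp: C_irrefl)

lemma blocks_through: "card {b \<in> B. in_block p b} = r - 2"
proof -
  have "{b \<in> B. in_block p b} = (\<lambda>j. (j, (p + j * (p div M)) mod M)) ` {..<r - 2}"
    using M_pos by (auto simp: B_def in_block_def image_iff)
  also have "card \<dots> = r - 2"
    by (subst card_image) (auto simp: inj_on_def)
  finally show ?thesis .
qed

lemma residue_shift:
  assumes "c < M"
  shows "\<exists>y<M. (y + a) mod M = c"
proof (intro exI conjI)
  \<comment> \<open>This is \<open>c - a\<close> modulo \<open>M\<close>, with
    \<open>M - a mod M\<close> representing \<open>- a\<close> among the naturals.\<close>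
  let ?y = "(c + (M - a mod M)) mod M"
  show "?y < M" using M_pos by simp
  have "(?y + a) mod M = (c + (M - a mod M) + a mod M) mod M"
    by (simp only: mod_add_left_eq mod_add_right_eq)
  also have "c + (M - a mod M) + a mod M = c + M"
    using mod_less_divisor[OF M_pos, of a] by linarith
  also have "(c + M) mod M = c"
    using assms by simp
  finally show "(?y + a) mod M = c" .
qed

text \<open>Taking the row number \<open>p div M\<close> is a bijection from the block onto the
  \<open>r + 1\<close> rows, as within a row the residue is determined.\<close>

lemma points_on:
  assumes "c < M"
  shows "card {p. p < N \<and> in_block p (j, c)} = r + 1"
proof -
  have "bij_betw (\<lambda>p. p div M) {p. p < N \<and> in_block p (j, c)} {..<r + 1}"
    unfolding bij_betw_def
  proof
    show "inj_on (\<lambda>p. p div M) {p. p < N \<and> in_block p (j, c)}"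
    proof (rule inj_onI, goal_cases)
      case (1 p q)
      then have "(p + j * (p div M)) mod M = (q + j * (p div M)) mod M"
        unfolding in_block_def by simp
      then have mod: "p mod M = q mod M"
        by (rule mod_add_cancel)
      have "p = p div M * M + p mod M"
        by simp
      also have "\<dots> = q div M * M + q mod M"
        by (simp only: 1(3) mod)
      also have "\<dots> = q"
        by simp
      finally show ?case .
    qed
    show "(\<lambda>p. p div M) ` {p. p < N \<and> in_block p (j, c)} = {..<r + 1}"
    proof (intro equalityI subsetI)
      fix x assume "x \<in> {..<r + 1}"
      then have x: "x < r + 1" by simp
      obtain y where y: "y < M" "(y + j * x) mod M = c"
        using residue_shift[OF assms] by blast
      let ?p = "x * M + y"
      have div: "?p div M = x"
        using y(1) by simp
      have "x * M \<le> r * M"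
        using x by (intro mult_le_mono1) simp
      moreover have "N = r * M + M"
        by (simp add: N_def)
      ultimately have "?p < N"
        using y(1) by linarith
      moreover have "in_block ?p (j, c)"
        unfolding in_block_def div fst_conv snd_conv add.assoc mod_mult_self3 by (rule y(2))
      ultimately show "x \<in> (\<lambda>p. p div M) ` {p. p < N \<and> in_block p (j, c)}"
        by (intro image_eqI[of _ _ ?p] CollectI conjI) (simp only: div)
    next
      fix x assume "x \<in> (\<lambda>p. p div M) ` {p. p < N \<and> in_block p (j, c)}"
      then obtain p where "x = p div M" "p < (r + 1) * M"
        unfolding N_def mult.commute[of M] by blast
      then show "x \<in> {..<r + 1}"
        using less_mult_imp_div_less[of p "r + 1" M] by simp
    qed
  qed
  then show ?thesis
    by (auto dest: bij_betw_same_card)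
qed

lemma neighbours_Inl:
  "{y \<in> F. adj (Inl p) y} = Inl ` {q. Inl q \<in> F \<and> C p q} \<union> Inr ` {b. Inr b \<in> F \<and> in_block p b}"
proof (intro equalityI subsetI)
  fix y assume "y \<in> {y \<in> F. adj (Inl p) y}"
  then show "y \<in> Inl ` {q. Inl q \<in> F \<and> C p q} \<union> Inr ` {b. Inr b \<in> F \<and> in_block p b}"
    by (cases y) auto
qed auto

lemma neighbours_Inr: "{y \<in> F. adj (Inr b) y} = Inl ` {q. Inl q \<in> F \<and> in_block q b}"
proof (intro equalityI subsetI)
  fix y assume "y \<in> {y \<in> F. adj (Inr b) y}"
  then show "y \<in> Inl ` {q. Inl q \<in> F \<and> in_block q b}"
    by (cases y) auto
qed auto

lemma card_neighbours_Inl: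
  assumes "finite F"
  shows "card {y \<in> F. adj (Inl p) y} =
    card {q. Inl q \<in> F \<and> C p q} + card {b. Inr b \<in> F \<and> in_block p b}"
proof -
  have "finite {q. Inl q \<in> F}" "finite {b. Inr b \<in> F}"
    using finite_vimageI[OF assms, of Inl] finite_vimageI[OF assms, of Inr] by (auto simp: vimage_def)
  then have "finite {q. Inl q \<in> F \<and> C p q}" "finite {b. Inr b \<in> F \<and> in_block p b}"
    by (auto elim: rev_finite_subset)
  then show ?thesis
    unfolding neighbours_Inl by (subst card_Un_disjoint) (auto simp: card_image)
qed

lemma degree_Inl: "p < N \<Longrightarrow> card {y \<in> V. adj (Inl p) y} = (if p \<in> S then r + 1 else r)"
  using card_neighbours_Inl[OF finite_V, of p] degree_C[of p] blocks_through[of p] r_ge by simp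

lemma degree_Inr: "b \<in> B \<Longrightarrow> card {y \<in> V. adj (Inr b) y} = r + 1"
  unfolding neighbours_Inr using points_on by (auto simp: card_image B_def)

text \<open>A cycle vertex lies in only \<open>r - 2\<close> blocks, so it keeps two cycle
  neighbours in \<open>F\<close> and \<open>C_core\<close> applies. \<open>F\<close> contains cycle
  vertices because blocks are adjacent to nothing else.\<close>

lemma adj_core:
  assumes F: "F \<subseteq> V" "F \<noteq> {}" and deg: "\<And>x. x \<in> F \<Longrightarrow> r \<le> card {y \<in> F. adj x y}"
  shows "L - 2 \<le> card F"
proof -
  have fin: "finite F"
    using F finite_V finite_subset by blast
  define F1 where "F1 = {p. Inl p \<in> F}"
  have sub: "Inl ` F1 \<subseteq> F"
    by (auto simp: F1_def)
  obtain x where x: "x \<in> F"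
    using F by blast
  have "F1 \<noteq> {}"
  proof (cases x)
    case (Inl p)
    then show ?thesis using x by (auto simp: F1_def)
  next
    case (Inr b)
    then have "{y \<in> F. adj (Inr b) y} \<noteq> {}"
      using deg[OF x] r_ge by (auto simp del: Collect_empty_eq)
    then show ?thesis
      unfolding neighbours_Inr by (auto simp: F1_def)
  qed
  moreover have "2 \<le> card {q \<in> F1. C p q}" if "p \<in> F1" for p
  proof -
    have "card {b. Inr b \<in> F \<and> in_block p b} \<le> card {b \<in> B. in_block p b}"
      using F by (intro card_mono) (auto simp: B_def)
    moreover have "r \<le> card {y \<in> F. adj (Inl p) y}"
      using deg that by (simp add: F1_def)
    ultimately show ?thesis
      using card_neighbours_Inl[OF fin, of p] blocks_through[of p] r_ge by (simp add: F1_def)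
  qed
  moreover have "F1 \<subseteq> {..<N}"
    using F by (auto simp: F1_def)
  ultimately have "L - 2 \<le> card F1"
    by (intro C_core)
  also have "\<dots> = card (Inl ` F1 :: (nat + nat \<times> nat) set)"
    by (simp add: card_image)
  also have "\<dots> \<le> card F"
    using sub fin by (intro card_mono)
  finally show ?thesis .
qed

text \<open>The point in row 0 determines the offset; the point in row 1 then determines the slope
  modulo \<open>M\<close>, and slopes are below \<open>M\<close>.\<close>

lemma block_unique:
  assumes "b \<in> B" "b' \<in> B" and same: "\<And>p. p < N \<Longrightarrow> in_block p b \<longleftrightarrow> in_block p b'"
  shows "b = b'"
proof -
  obtain j c j' c' where b: "b = (j, c)" "b' = (j', c')"
    by (metis prod.exhaust)
  then have lt: "c < M" "c' < M" "j < M" "j' < M"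
    using assms(1,2) r_le_M by (auto simp: B_def)
  have N: "2 * M \<le> N"
    unfolding N_def using r_ge by simp
  have "in_block c b"
    using lt by (simp add: in_block_def b)
  then have "in_block c b'"
    using same[of c] lt N by auto
  then have c: "c = c'"
    using lt by (simp add: in_block_def b)
  obtain y where y: "y < M" "(y + j) mod M = c"
    using residue_shift[OF lt(1)] by blast
  have div: "(M + y) div M = 1"
    using y M_pos div_add_self1[of M y] by simp
  have "in_block (M + y) b"
    using y by (simp add: in_block_def b div add.assoc)
  then have "in_block (M + y) b'"
    using same[of "M + y"] y N by auto
  then have "(j' + (M + y)) mod M = (j + (M + y)) mod M"
    using \<open>in_block (M + y) b\<close> unfolding in_block_def b fst_conv snd_conv div c
    by (simp only: mult_1_right add.commute)
  then have "j' mod M = j mod M"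
    by (rule mod_add_cancel)
  then show ?thesis
    using b c lt by simp
qed

text \<open>Counting neighbours of degree \<open>r + 1\<close> separates blocks from branch
  vertices. The restriction to the cycle is then the identity by \<open>C_rigid\<close>, and blocks
  are determined by their points.\<close>

lemma rigid_adj: "rigid V adj"
  unfolding rigid_def
proof (intro allI impI, elim conjE)
  fix \<psi> assume bij: "bij_betw \<psi> V V" and hom: "\<forall>x\<in>V. \<forall>y\<in>V. adj (\<psi> x) (\<psi> y) \<longleftrightarrow> adj x y"
  have inj: "inj_on \<psi> V" and onto: "\<psi> ` V = V"
    using bij by (auto simp: bij_betw_def)
  have in_V: "\<psi> x \<in> V" if "x \<in> V" for x
    using onto that by blast
  have image_nb: "{y \<in> V. adj (\<psi> x) y \<and> P y} = \<psi> ` {y \<in> V. adj x y \<and> P (\<psi> y)}" if "x \<in> V" for x P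
  proof (intro equalityI subsetI)
    fix y assume y: "y \<in> {y \<in> V. adj (\<psi> x) y \<and> P y}"
    then obtain y' where "y' \<in> V" "y = \<psi> y'"
      using onto by blast
    then show "y \<in> \<psi> ` {y \<in> V. adj x y \<and> P (\<psi> y)}"
      using y hom that by auto
  qed (use hom that in_V in auto)
  \<comment> \<open>Taking \<open>P\<close> constantly true compares degrees; taking
    \<open>P\<close> as \<open>big\<close> compares the numbers of big neighbours.\<close>
  have card_nb: "card {y \<in> V. adj (\<psi> x) y \<and> P y} = card {y \<in> V. adj x y \<and> P (\<psi> y)}"
    if "x \<in> V" for x P
    unfolding image_nb[OF that] by (intro card_image inj_on_subset[OF inj]) auto
  define big where "big x \<longleftrightarrow> card {y \<in> V. adj x y} = r + 1" for x
  have big_psi: "big (\<psi> x) \<longleftrightarrow> big x" if "x \<in> V" for x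
    using card_nb[OF that, of "\<lambda>_. True"] by (simp add: big_def)
  have big_Inl: "big (Inl p) \<longleftrightarrow> p \<in> S" if "p < N" for p
    using degree_Inl[OF that] by (simp add: big_def)
  have big_Inr: "big (Inr b)" if "b \<in> B" for b
    using degree_Inr[OF that] by (simp add: big_def)
  \<comment> \<open>Big neighbours of a block are branch vertices, so they lie in row 0, which the
    block meets only in \<open>snd b\<close>.\<close>
  have few: "card {y \<in> V. adj (Inr b) y \<and> big y} \<le> 1" if "b \<in> B" for b
  proof -
    have "{y \<in> V. adj (Inr b) y \<and> big y} \<subseteq> {Inl (snd b)}"
    proof
      fix y assume y: "y \<in> {y \<in> V. adj (Inr b) y \<and> big y}"
      then obtain q where q: "y = Inl q" "in_block q b" "q < N"
        by (cases y) auto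
      then have "q < M"
        using y big_Inl S_less[of q] by (auto simp: M_def)
      then show "y \<in> {Inl (snd b)}"
        using q by (simp add: in_block_def)
    qed
    then have "card {y \<in> V. adj (Inr b) y \<and> big y} \<le> card {Inl (snd b) :: nat + nat \<times> nat}"
      by (rule card_mono[rotated]) simp
    then show ?thesis by simp
  qed
  \<comment> \<open>One big neighbour is another branch vertex; the other is a block through
    \<open>s\<close>, which exists because a nonempty \<open>B\<close> means
    \<open>2 < r\<close>.\<close>
  have many: "2 \<le> card {y \<in> V. adj (Inl s) y \<and> big y}" if "s \<in> S" "B \<noteq> {}" for s
  proof -
    have SN: "S \<subseteq> {..<N}"
    proof
      fix s assume "s \<in> S"
      then have "s < 3 * L" by (rule S_less)
      then show "s \<in> {..<N}" using N_ge by simp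
    qed
    have "s = 0 \<or> s = 1 \<or> s = L \<or> s = 2 * L"
      using that(1) by (simp add: S_def)
    moreover have "C 0 1" "C 1 0" "C L 0" "C (2 * L) 1"
      by (auto simp: C_def)
    moreover have "0 \<in> S" "1 \<in> S"
      by (simp_all add: S_def)
    ultimately obtain t where t: "t \<in> S" "C s t"
      by metis
    have "0 < r - 2"
      using that(2) by (auto simp: B_def)
    then have "{b \<in> B. in_block s b} \<noteq> {}"
      using blocks_through[of s] by (metis card.empty less_numeral_extra(3))
    then obtain b where b: "b \<in> B" "in_block s b" by blast
    have "{Inl t, Inr b} \<subseteq> {y \<in> V. adj (Inl s) y \<and> big y}"
      using t b SN big_Inl big_Inr by auto
    then have "card {Inl t, Inr b} \<le> card {y \<in> V. adj (Inl s) y \<and> big y}"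
      using finite_V by (intro card_mono) auto
    then show ?thesis by simp
  qed
  have Inr_to: "\<psi> (Inr b) \<in> Inr ` B" if b: "b \<in> B" for b
  proof (cases "\<psi> (Inr b)")
    case (Inl s)
    have bV: "Inr b \<in> V" using b by simp
    have "s < N"
      using in_V[OF bV] Inl by simp
    moreover have "big (Inl s)"
      using big_psi[OF bV] big_Inr[OF b] Inl by simp
    ultimately have "2 \<le> card {y \<in> V. adj (Inl s) y \<and> big y}"
      using many big_Inl b by blast
    also have "\<dots> = card {y \<in> V. adj (Inr b) y \<and> big (\<psi> y)}"
      using card_nb[OF bV, of big] Inl by simp
    also have "\<dots> = card {y \<in> V. adj (Inr b) y \<and> big y}"
      using big_psi by (intro arg_cong[where f = card]) auto
    also have "\<dots> \<le> 1"
      using few[OF b] .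
    finally show ?thesis by simp
  next
    case (Inr b')
    then show ?thesis using in_V[of "Inr b"] b by auto
  qed
  have finB: "finite (Inr ` B :: (nat + nat \<times> nat) set)"
    by (simp add: B_def)
  \<comment> \<open>An injective self-map of the finite set of blocks is onto, so no cycle vertex
    can be mapped to a block.\<close>
  have "\<psi> ` Inr ` B = Inr ` B"
    using Inr_to finB inj by (intro endo_inj_surj) (auto intro: inj_on_subset)
  then have Inl_to: "\<psi> (Inl p) \<in> Inl ` {..<N}" if "p < N" for p
  proof (cases "\<psi> (Inl p)")
    case (Inl q)
    then show ?thesis using in_V[of "Inl p"] that by auto
  next
    case (Inr b)
    then have "b \<in> B"
      using in_V[of "Inl p"] that by simp
    then obtain b' where "b' \<in> B" "\<psi> (Inr b') = Inr b"
      using \<open>\<psi> ` Inr ` B = Inr ` B\<close> by (metis (no_types, lifting) imageE imageI)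
    then show ?thesis
      using inj_onD[OF inj, of "Inl p" "Inr b'"] Inr that by simp
  qed
  define \<theta> where "\<theta> p = projl (\<psi> (Inl p))" for p
  have \<theta>: "\<psi> (Inl p) = Inl (\<theta> p)" "\<theta> p < N" if "p < N" for p
    using Inl_to[OF that] by (auto simp: \<theta>_def)
  have fix_Inl: "\<psi> (Inl p) = Inl p" if "p < N" for p
  proof -
    have "inj_on \<theta> {..<N}"
    proof (rule inj_onI)
      fix p q assume "p \<in> {..<N}" "q \<in> {..<N}" "\<theta> p = \<theta> q"
      then show "p = q"
        using inj_onD[OF inj, of "Inl p" "Inl q"] \<theta> by simp
    qed
    moreover have "C (\<theta> p) (\<theta> q) \<longleftrightarrow> C p q" if "p < N" "q < N" for p q
      using hom[rule_format, of "Inl p" "Inl q"] that \<theta> by simp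
    ultimately have "\<theta> p = p"
      using C_rigid[of \<theta> p] \<theta>(2) that by blast
    then show ?thesis
      using \<theta>(1)[OF that] by simp
  qed
  have fix_Inr: "\<psi> (Inr b) = Inr b" if "b \<in> B" for b
  proof -
    obtain b' where b': "b' \<in> B" "\<psi> (Inr b) = Inr b'"
      using Inr_to[OF \<open>b \<in> B\<close>] by blast
    have "in_block p b \<longleftrightarrow> in_block p b'" if "p < N" for p
      using hom[rule_format, of "Inl p" "Inr b"] that \<open>b \<in> B\<close> fix_Inl b' by simp
    then show ?thesis
      using block_unique[of b b'] that b' by simp
  qed
  show "\<forall>x\<in>V. \<psi> x = x"
    using fix_Inl fix_Inr by (auto simp: V_def)
qed

end

section \<open>Infinitely many minimal asymmetric hypergraphs\<close>

lemma minimal_asymmetric_many_edges: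
  assumes "3 \<le> k"
  shows "\<exists>G :: nat hypergraph. k_graph k G \<and> minimal_asymmetric G \<and>
           max_degree G = 2 \<and> max_codegree G = 1 \<and> n \<le> card (edges G)"
proof -
  obtain r where k: "k = r + 1" and r: "2 \<le> r"
    using assms that[of "k - 1"] by auto
  \<comment> \<open>Then \<open>L - 2 = n + r\<close> is at least \<open>n\<close>, as
    \<open>adj_core\<close> requires for the bound, and \<open>r + 2 \<le> L\<close> holds.\<close>
  obtain L where L: "L = n + r + 2"
    by blast
  interpret block_graph r L
    using r L by unfold_locales auto
  show ?thesis
  proof (rule minimal_asymmetric_from_graph[of V k adj n])
    have "Inl 0 \<in> V"
      using N_ge L_ge by simp
    then show "V \<noteq> {}" by blast
    show "card {y \<in> V. adj x y} = k - 1 \<or> card {y \<in> V. adj x y} = k" if "x \<in> V" for x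
    proof (cases x)
      case (Inl p)
      then have "p < N" using that by simp
      then show ?thesis
        unfolding Inl degree_Inl[OF \<open>p < N\<close>] by (simp add: k)
    next
      case (Inr b)
      then have "b \<in> B" using that by simp
      then show ?thesis
        unfolding Inr degree_Inr[OF \<open>b \<in> B\<close>] by (simp add: k)
    qed
    show "n \<le> card F"
      if "F \<subseteq> V" "F \<noteq> {}" "\<And>x. x \<in> F \<Longrightarrow> k - 1 \<le> card {y \<in> F. adj x y}" for F
      using adj_core[of F] that by (simp add: k L)
    show "adj y x" if "adj x y" for x y
      using that by (rule adj_sym)
    show "\<not> adj x x" for x
      by (rule adj_irrefl)
  qed (rule finite_V assms rigid_adj)+
qed

lemma isomorphic_card_edges:
  assumes "k_graph k G" "isomorphic G H"
  shows "card (edges G) = card (edges H)"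
proof -
  obtain \<phi> where \<phi>: "bij_betw \<phi> (verts G) (verts H)" "(\<lambda>X. \<phi> ` X) ` edges G = edges H"
    using assms(2) unfolding isomorphic_def by blast
  have "inj_on (\<lambda>X. \<phi> ` X) (Pow (verts G))"
    using \<phi>(1) by (intro inj_on_image_Pow) (simp add: bij_betw_def)
  then have "inj_on (\<lambda>X. \<phi> ` X) (edges G)"
    by (rule inj_on_subset) (use assms(1) in \<open>auto simp: k_graph_def\<close>)
  then show ?thesis
    using card_image \<phi>(2) by metis
qed

theorem theorem2:
  fixes k :: nat
  assumes "k \<ge> 3"
  shows "\<exists>\<G> :: nat hypergraph set.
           infinite \<G> \<and>
           pairwise (\<lambda>G H. \<not> isomorphic G H) \<G> \<and>
           (\<forall>G\<in>\<G>. k_graph k G \<and> minimal_asymmetric G \<and>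
                   max_degree G = 2 \<and> max_codegree G = 1)"
proof -
  define P :: "nat hypergraph set" where
    "P = {G. k_graph k G \<and> minimal_asymmetric G \<and> max_degree G = 2 \<and> max_codegree G = 1}"
  define c :: "nat hypergraph \<Rightarrow> nat" where "c G = card (edges G)" for G
  have "\<exists>m\<ge>n. m \<in> c ` P" for n
  proof -
    obtain G where "G \<in> P" "n \<le> c G"
      using minimal_asymmetric_many_edges[OF assms, of n] unfolding P_def c_def by blast
    then show ?thesis by blast
  qed
  then have inf: "infinite (c ` P)"
    unfolding finite_nat_set_iff_bounded by (meson not_less)
  \<comment> \<open>One representative is chosen for each attained number of edges, so distinct
    members differ in an isomorphism invariant.\<close>
  define \<G> where "\<G> = inv_into P c ` c ` P"
  have sub: "\<G> \<subseteq> P"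
    by (auto simp: \<G>_def inv_into_into)
  have c_inj: "inj_on c \<G>"
    by (auto simp: \<G>_def inj_on_def f_inv_into_f)
  have "infinite \<G>"
    unfolding \<G>_def using inf finite_imageD inj_on_inv_into by blast
  moreover have "pairwise (\<lambda>G H. \<not> isomorphic G H) \<G>"
  proof (rule pairwiseI)
    fix G H assume "G \<in> \<G>" "H \<in> \<G>" "G \<noteq> H"
    then have "c G \<noteq> c H" "k_graph k G"
      using c_inj sub by (auto dest: inj_onD simp: P_def)
    then show "\<not> isomorphic G H"
      using isomorphic_card_edges unfolding c_def by blast
  qed
  ultimately show ?thesis
    using sub by (intro exI[of _ \<G>]) (auto simp: P_def)
qed

end
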